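(* Let $U\subset\mathbb{R}$ be an open interval, let $I\subset U$ be a compact interval, and let $\gamma:U\to\mathbb{R}^n$ be a $C^{n+1}$ embedding satisfying $$\det\bigl(\gamma'(t),\ldots,\gamma^{(n)}(t)\bigr)\ne0,\qquad t\in I.$$ Let $T\subset I$ be a compact Ahlfors $s$-regular set, where $0<s\le1$, with $\operatorname{diam}T>0$. Then, uniformly for $\delta\in\Delta_n$, $$N(\gamma(T);\delta)\asymp\Bigl(\min_{1\le i\le n}\delta_i^{1/i}\Bigr)^{-s};$$ that is, each side is at most a positive constant times the other, where the constants may depend on $\gamma$, $I$, and the Ahlfors regularity data of $T$, but not on $\delta\in\Delta_n$.
   Context: A compact set $T\subset\mathbb{R}$ with $\operatorname{diam}T>0$ is Ahlfors $s$-regular, $0<s\le1$, if there are a finite Borel measure $\mu$ with support $\operatorname{spt}\mu=T$ and constants $0<c_T\le C_T<\infty$ such that $c_Tr^s\le\mu(T\cap[t-r,t+r])\le C_Tr^s$ for every $t\in T$ and $0<r\le\operatorname{diam}T$. An open box in $\mathbb{R}^n$ is an open rectangular box with positive side lengths and arbitrary orientation; its side lengths in decreasing order are $l_1(B)\ge\cdots\ge l_n(B)>0$. Let $\Delta_n=\{\delta\in(0,1)^n:\delta_1\ge\cdots\ge\delta_n\}$. For non-empty bounded $F\subset\mathbb{R}^n$ and $\delta\in\Delta_n$, $N(F;\delta)$ is the least number of open boxes $B$ needed to cover $F$, subject to $l_i(B)\le\delta_i$ for $1\le i\le n$ for every box in the cover (boxes may have different orientations). *)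

theory Defs
  imports "HOL-Analysis.Analysis"
begin

section \<open>Curves\<close>

definition nth_vderiv :: "nat \<Rightarrow> (real \<Rightarrow> 'a::real_normed_vector) \<Rightarrow> real \<Rightarrow> 'a" where
  "nth_vderiv k f = ((\<lambda>g t. vector_derivative g (at t)) ^^ k) f"

text \<open>Intended for open \<open>U\<close>, so that the derivatives depend only on the values of \<open>f\<close> on \<open>U\<close>.\<close>

definition Ck_on :: "nat \<Rightarrow> (real \<Rightarrow> 'a::real_normed_vector) \<Rightarrow> real set \<Rightarrow> bool" where
  "Ck_on k f U \<longleftrightarrow>
     (\<forall>j<k. \<forall>t\<in>U. nth_vderiv j f differentiable (at t)) \<and> continuous_on U (nth_vderiv k f)"

text \<open>An embedding in the sense of differential topology: an immersion that is a homeomorphism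
  onto its image.\<close>

definition Ck_embedding :: "nat \<Rightarrow> (real \<Rightarrow> 'a::real_normed_vector) \<Rightarrow> real set \<Rightarrow> bool" where
  "Ck_embedding k f U \<longleftrightarrow>
     Ck_on k f U \<and> (\<forall>t\<in>U. vector_derivative f (at t) \<noteq> 0) \<and>
     embedding_map (top_of_set U) euclidean f"

text \<open>The index type \<open>'n\<close> carries no order, so a numbering \<open>idx\<close> of it by \<open>1, \<dots>, n\<close>
  (a bijection onto \<open>{1..CARD('n)}\<close>) is used to arrange \<open>f', \<dots>, f\<^sup>(\<^sup>n\<^sup>)\<close> as the columns of a
  matrix; another numbering changes the determinant at most by its sign.\<close>

definition derivs_det :: "('n \<Rightarrow> nat) \<Rightarrow> (real \<Rightarrow> real ^ 'n) \<Rightarrow> real \<Rightarrow> real" where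
  "derivs_det idx f t = det ((\<chi> i j. nth_vderiv (idx j) f t $ i) :: real ^ 'n ^ 'n)"


section \<open>Ahlfors regular sets\<close>

definition measure_spt :: "'a::topological_space measure \<Rightarrow> 'a set" where
  "measure_spt \<mu> = {x. \<forall>V. open V \<and> x \<in> V \<longrightarrow> 0 < emeasure \<mu> V}"

text \<open>Ahlfors \<open>s\<close>-regularity of \<open>T\<close> with explicit constants \<open>c\<close> and \<open>C\<close>.\<close>

definition ahlfors_regular_with :: "real \<Rightarrow> real \<Rightarrow> real \<Rightarrow> real set \<Rightarrow> bool" where
  "ahlfors_regular_with s c C T \<longleftrightarrow>
     compact T \<and> 0 < diameter T \<and> 0 < s \<and> s \<le> 1 \<and> 0 < c \<and> c \<le> C \<and>
     (\<exists>\<mu> :: real measure. finite_measure \<mu> \<and> sets \<mu> = sets borel \<and> measure_spt \<mu> = T \<and>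
        (\<forall>t\<in>T. \<forall>r. 0 < r \<and> r \<le> diameter T \<longrightarrow>
           c * r powr s \<le> measure \<mu> (T \<inter> {t - r..t + r}) \<and>
           measure \<mu> (T \<inter> {t - r..t + r}) \<le> C * r powr s))"


section \<open>Covering numbers by boxes\<close>

text \<open>Finite sequences indexed by \<open>1, \<dots>, n\<close> are functions on \<open>nat\<close> of which only the values on
  \<open>{1..n}\<close> matter.\<close>

definition Delta :: "nat \<Rightarrow> (nat \<Rightarrow> real) set" where
  "Delta n = {\<delta>. (\<forall>i\<in>{1..n}. 0 < \<delta> i \<and> \<delta> i < 1) \<and>
                  (\<forall>i\<in>{1..n}. \<forall>j\<in>{1..n}. i \<le> j \<longrightarrow> \<delta> j \<le> \<delta> i)}"

text \<open>\<open>B\<close> is the open box with centre \<open>p\<close> whose edges are parallel to the orthonormal frame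
  \<open>u 1, \<dots>, u n\<close> and have the lengths \<open>l 1 \<ge> \<dots> \<ge> l n > 0\<close>.\<close>

definition open_box_with_sides :: "(real ^ 'n) set \<Rightarrow> (nat \<Rightarrow> real) \<Rightarrow> bool" where
  "open_box_with_sides B l \<longleftrightarrow>
     (\<forall>i\<in>{1..CARD('n)}. 0 < l i) \<and>
     (\<forall>i\<in>{1..CARD('n)}. \<forall>j\<in>{1..CARD('n)}. i \<le> j \<longrightarrow> l j \<le> l i) \<and>
     (\<exists>p u. (\<forall>i\<in>{1..CARD('n)}. \<forall>j\<in>{1..CARD('n)}. u i \<bullet> u j = (if i = j then 1 else 0)) \<and>
            B = {x. \<forall>i\<in>{1..CARD('n)}. \<bar>(x - p) \<bullet> u i\<bar> < l i / 2})"

definition admissible_box :: "(nat \<Rightarrow> real) \<Rightarrow> (real ^ 'n) set \<Rightarrow> bool" where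
  "admissible_box \<delta> B \<longleftrightarrow> (\<exists>l. open_box_with_sides B l \<and> (\<forall>i\<in>{1..CARD('n)}. l i \<le> \<delta> i))"

text \<open>Meaningful for bounded \<open>F\<close> and \<open>\<delta> \<in> Delta CARD('n)\<close>, when finite covers exist.\<close>

definition box_covering_number :: "(real ^ 'n) set \<Rightarrow> (nat \<Rightarrow> real) \<Rightarrow> nat" where
  "box_covering_number F \<delta> =
     (LEAST k. \<exists>\<B>. finite \<B> \<and> card \<B> = k \<and> (\<forall>B\<in>\<B>. admissible_box \<delta> B) \<and> F \<subseteq> \<Union>\<B>)"

end

theory Submission
  imports Defs
begin

text \<open>
  Put \<open>\<rho> = min\<^sub>i \<delta> i powr (1 / i)\<close>, the largest scale with \<open>\<rho> ^ i \<le> \<delta> i\<close> for all \<open>i\<close>. An admissible box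
  can contain an arc of the curve of parameter length comparable to \<open>\<rho>\<close>, and it cannot contain
  essentially more than boundedly many such arcs; so \<open>N(\<gamma>(T); \<delta>)\<close> is comparable to the number of
  intervals of length \<open>\<rho>\<close> needed to cover \<open>T\<close>, which Ahlfors regularity makes comparable to
  \<open>\<rho> powr (- s)\<close>.

  Upper bound. At a parameter \<open>x\<close> choose an orthonormal frame in which \<open>u i\<close> is orthogonal to the
  derivatives of order \<open>1, \<dots>, i - 1\<close>. By Taylor's formula the \<open>i\<close>-th coordinate of \<open>\<gamma> t - \<gamma> x\<close>
  is of order \<open>\<bar>t - x\<bar> ^ i\<close>, so an arc of length a small multiple of \<open>\<rho>\<close> fits into a box with
  sides \<open>\<delta>\<close> (\<open>short_arc_in_admissible_box\<close>).

  Lower bound. Let \<open>i\<close> attain the minimum, \<open>\<delta> i = \<rho> ^ i\<close>. In the directions \<open>u i, \<dots>, u n\<close> of its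
  shorter sides, any admissible box has width at most \<open>\<rho> ^ i\<close>. The first \<open>i\<close> derivatives of the curve
  are independent and cannot all be orthogonal to these \<open>n - i + 1\<close> directions; by compactness one of
  them, of some order \<open>k \<le> i\<close>, has a component bounded below uniformly in the parameter and the box
  (\<open>derivatives_not_orthogonal_to_tail\<close>). A function whose \<open>k\<close>-th derivative is bounded away from \<open>0\<close>
  on an interval has absolute value at most \<open>\<rho> ^ i\<close> only on a set covered by a bounded number of
  intervals of length comparable to \<open>\<rho> ^ (i / k) \<le> \<rho>\<close> (\<open>sublevel_separated_card\<close>). Hence each box
  captures boundedly many intervals of length comparable to \<open>\<rho>\<close> (\<open>slab_preimage_net\<close>).
\<close>

section \<open>Separated nets on the line\<close>

text \<open>An \<open>r\<close>-separated subset of a bounded interval has at most one point in each cell of a grid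
  of mesh \<open>r\<close>; hence one of largest cardinality exists, and by maximality it is an \<open>r\<close>-net.\<close>

lemma maximal_separated_subset:
  fixes S :: "real set" and r :: real
  assumes "S \<subseteq> {a..b}" and "0 < r"
  obtains P where "finite P" and "P \<subseteq> S"
    and "\<And>x y. x \<in> P \<Longrightarrow> y \<in> P \<Longrightarrow> x \<noteq> y \<Longrightarrow> r \<le> \<bar>x - y\<bar>"
    and "S \<subseteq> (\<Union>x\<in>P. {x - r..x + r})"
proof -
  define sep where "sep P \<longleftrightarrow> finite P \<and> P \<subseteq> S \<and> (\<forall>x\<in>P. \<forall>y\<in>P. x \<noteq> y \<longrightarrow> r \<le> \<bar>x - y\<bar>)" for P
  have bound: "card P < Suc (card {0..\<lfloor>(b - a) / r\<rfloor>})" if "sep P" for P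
  proof -
    have "inj_on (\<lambda>x. \<lfloor>(x - a) / r\<rfloor>) P"
    proof (rule inj_onI, rule ccontr)
      fix x y assume xy: "x \<in> P" "y \<in> P" "\<lfloor>(x - a) / r\<rfloor> = \<lfloor>(y - a) / r\<rfloor>" "x \<noteq> y"
      have "\<bar>(x - a) / r - (y - a) / r\<bar> < 1" using xy(3) by linarith
      moreover have "(x - a) / r - (y - a) / r = (x - y) / r" by (simp add: diff_divide_distrib)
      ultimately have "\<bar>x - y\<bar> < r" using \<open>0 < r\<close> by (simp add: abs_divide)
      thus False using xy \<open>sep P\<close> by (force simp: sep_def)
    qed
    moreover have "(\<lambda>x. \<lfloor>(x - a) / r\<rfloor>) ` P \<subseteq> {0..\<lfloor>(b - a) / r\<rfloor>}"
    proof (rule image_subsetI)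
      fix x assume "x \<in> P"
      hence "a \<le> x" "x \<le> b" using \<open>sep P\<close> assms(1) by (auto simp: sep_def)
      hence "0 \<le> (x - a) / r" "(x - a) / r \<le> (b - a) / r"
        using \<open>0 < r\<close> by (auto intro: divide_right_mono)
      thus "\<lfloor>(x - a) / r\<rfloor> \<in> {0..\<lfloor>(b - a) / r\<rfloor>}" by (simp add: floor_mono)
    qed
    ultimately show ?thesis using card_inj_on_le[of _ P] by (metis finite_atLeastAtMost_int le_imp_less_Suc)
  qed
  have "sep {}" by (simp add: sep_def)
  then obtain P where P: "sep P" and max: "\<And>Q. sep Q \<Longrightarrow> card Q \<le> card P"
    using ex_has_greatest_nat[of sep "{}" card] bound by blast
  have "\<exists>x\<in>P. y \<in> {x - r..x + r}" if "y \<in> S" for y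
  proof (rule ccontr)
    assume far: "\<not> ?thesis"
    hence "sep (insert y P)" "y \<notin> P"
      using P that \<open>0 < r\<close> by (auto simp: sep_def)
    thus False using max[of "insert y P"] P by (simp add: sep_def)
  qed
  thus thesis using P by (intro that[of P]) (auto simp: sep_def)
qed

section \<open>Mean value estimates for functions of one variable\<close>

text \<open>A quantitative iterated Rolle theorem. Grouping \<open>2\<^sup>k\<close> points into consecutive disjoint pairs, the
  mean value theorem gives half as many points at which the derivative is at most \<open>2 \<epsilon> / r\<close>. One uses
  disjoint pairs, and not all pairs of neighbours, because the new points are then again
  \<open>r\<close>-separated, so that the step can be repeated.\<close>

lemma sublevel_separated:
  fixes F :: "nat \<Rightarrow> real \<Rightarrow> real" and x :: "nat \<Rightarrow> real"
  assumes "is_interval J" and "0 < r"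
    and "\<And>j t. j < k \<Longrightarrow> t \<in> J \<Longrightarrow> (F j has_real_derivative F (Suc j) t) (at t)"
    and "\<And>i. i < 2 ^ k \<Longrightarrow> x i \<in> J \<and> \<bar>F 0 (x i)\<bar> \<le> \<epsilon>"
    and "\<And>i. Suc i < 2 ^ k \<Longrightarrow> x i + r \<le> x (Suc i)"
  shows "\<exists>\<xi>\<in>J. \<bar>F k \<xi>\<bar> \<le> \<epsilon> * (2 / r) ^ k"
  using assms(3-5)
proof (induction k arbitrary: F x \<epsilon>)
  case 0
  then show ?case by (auto intro!: bexI[of _ "x 0"])
next
  case (Suc k)
  have "\<exists>\<xi>. x (2 * i) < \<xi> \<and> \<xi> < x (Suc (2 * i)) \<and> \<xi> \<in> J \<and> \<bar>F (Suc 0) \<xi>\<bar> \<le> \<epsilon> * (2 / r)" 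
    if "i < 2 ^ k" for i
  proof -
    let ?y = "x (2 * i)" and ?z = "x (Suc (2 * i))"
    have i: "Suc (2 * i) < 2 ^ Suc k" using that by simp
    have yz: "?y + r \<le> ?z" and ends: "?y \<in> J" "?z \<in> J" "\<bar>F 0 ?y\<bar> \<le> \<epsilon>" "\<bar>F 0 ?z\<bar> \<le> \<epsilon>"
      using Suc.prems(3)[OF i] Suc.prems(2)[OF i] Suc.prems(2)[of "2 * i"] i by auto
    have J: "t \<in> J" if "?y \<le> t" "t \<le> ?z" for t
      using \<open>is_interval J\<close> ends that unfolding is_interval_1 by blast
    obtain \<xi> where xi: "?y < \<xi>" "\<xi> < ?z" "F 0 ?z - F 0 ?y = (?z - ?y) * F (Suc 0) \<xi>"
      using MVT2[of ?y ?z "F 0" "F (Suc 0)"] Suc.prems(1)[of 0] J yz \<open>0 < r\<close> by auto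
    have "r * \<bar>F (Suc 0) \<xi>\<bar> \<le> \<bar>(?z - ?y) * F (Suc 0) \<xi>\<bar>"
      using yz \<open>0 < r\<close> by (simp add: abs_mult mult_right_mono)
    also have "\<dots> \<le> 2 * \<epsilon>" using ends unfolding xi(3)[symmetric] by linarith
    finally show ?thesis using xi J \<open>0 < r\<close> by (intro exI[of _ \<xi>]) (auto simp: field_simps)
  qed
  then obtain y where y: "\<And>i. i < 2 ^ k \<Longrightarrow> x (2 * i) < y i \<and> y i < x (Suc (2 * i)) \<and> y i \<in> J \<and>
      \<bar>F (Suc 0) (y i)\<bar> \<le> \<epsilon> * (2 / r)" by metis
  have "\<exists>\<xi>\<in>J. \<bar>F (Suc k) \<xi>\<bar> \<le> (\<epsilon> * (2 / r)) * (2 / r) ^ k"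
  proof (rule Suc.IH[of "\<lambda>j. F (Suc j)" y])
    fix i assume i: "Suc i < 2 ^ k"
    have "x (Suc (2 * i)) + r \<le> x (2 * Suc i)" using Suc.prems(3)[of "Suc (2 * i)"] i by simp
    thus "y i + r \<le> y (Suc i)" using y[of i] y[of "Suc i"] i by auto
  qed (use y Suc.prems(1) in auto)
  thus ?case by (simp add: mult.assoc)
qed

text \<open>The contrapositive, a crude sublevel set estimate: if the \<open>k\<close>-th derivative stays away from \<open>0\<close>,
  then the set where \<open>F 0\<close> is small has few points at mutual distance \<open>r\<close>.\<close>

lemma sublevel_separated_card:
  fixes F :: "nat \<Rightarrow> real \<Rightarrow> real"
  assumes "is_interval J" and "0 < r"
    and deriv: "\<And>j t. j < k \<Longrightarrow> t \<in> J \<Longrightarrow> (F j has_real_derivative F (Suc j) t) (at t)"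
    and P: "finite P" "P \<subseteq> J" "\<And>x y. x \<in> P \<Longrightarrow> y \<in> P \<Longrightarrow> x \<noteq> y \<Longrightarrow> r \<le> \<bar>x - y\<bar>"
    and small: "\<And>x. x \<in> P \<Longrightarrow> \<bar>F 0 x\<bar> \<le> \<epsilon>"
    and large: "\<And>t. t \<in> J \<Longrightarrow> \<epsilon> * (2 / r) ^ k < \<bar>F k t\<bar>"
  shows "card P < 2 ^ k"
proof (rule ccontr)
  assume "\<not> ?thesis"
  hence len: "2 ^ k \<le> length (sorted_list_of_set P)" by simp
  define x where "x = nth (sorted_list_of_set P)"
  have xP: "x i \<in> P" if "i < 2 ^ k" for i
    using that len nth_mem[of i "sorted_list_of_set P"] P(1) by (simp add: x_def)
  have gap: "x i + r \<le> x (Suc i)" if "Suc i < 2 ^ k" for i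
  proof -
    have "x i < x (Suc i)"
      using sorted_wrt_nth_less[OF strict_sorted_list_of_set[of P], of i "Suc i"] that len
      by (simp add: x_def)
    thus ?thesis using P(3)[of "x i" "x (Suc i)"] xP[of i] xP[of "Suc i"] that by auto
  qed
  obtain \<xi> where "\<xi> \<in> J" "\<bar>F k \<xi>\<bar> \<le> \<epsilon> * (2 / r) ^ k"
    using sublevel_separated[of J r k F x \<epsilon>] assms(1,2) deriv xP gap P(2) small by blast
  thus False using large[of \<xi>] by simp
qed

text \<open>Taylor's estimate at a zero of order \<open>k\<close>: each of the \<open>k\<close> applications of the mean value
  theorem contributes one factor \<open>\<bar>t - x\<bar>\<close>.\<close>

lemma vanishing_derivatives_bound:
  fixes F :: "nat \<Rightarrow> real \<Rightarrow> real"
  assumes "\<And>j t. j < k \<Longrightarrow> t \<in> {a..b} \<Longrightarrow> (F j has_real_derivative F (Suc j) t) (at t)"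
    and "\<And>j. j < k \<Longrightarrow> F j x = 0" and "\<And>t. t \<in> {a..b} \<Longrightarrow> \<bar>F k t\<bar> \<le> M"
    and "x \<in> {a..b}" "t \<in> {a..b}"
  shows "\<bar>F 0 t\<bar> \<le> M * \<bar>t - x\<bar> ^ k"
  using assms
proof (induction k arbitrary: F t)
  case 0
  then show ?case by simp
next
  case (Suc k)
  have M: "0 \<le> M" using Suc.prems(3)[of x] Suc.prems(4) by linarith
  have mvt: "\<exists>\<xi>\<in>{a..b}. \<bar>\<xi> - x\<bar> \<le> \<bar>t - x\<bar> \<and> \<bar>F 0 t\<bar> = \<bar>t - x\<bar> * \<bar>F (Suc 0) \<xi>\<bar>"
  proof (cases t x rule: linorder_cases)
    case less
    then obtain \<xi> where "t < \<xi>" "\<xi> < x" "F 0 x - F 0 t = (x - t) * F (Suc 0) \<xi>"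
      using MVT2[of t x "F 0" "F (Suc 0)"] Suc.prems by force
    moreover have "F 0 x = 0" using Suc.prems by simp
    ultimately have "F 0 t = (t - x) * F (Suc 0) \<xi>" by (simp add: algebra_simps)
    thus ?thesis using \<open>t < \<xi>\<close> \<open>\<xi> < x\<close> Suc.prems(4,5)
      by (intro bexI[of _ \<xi>]) (auto simp: abs_mult)
  next
    case greater
    then obtain \<xi> where "x < \<xi>" "\<xi> < t" "F 0 t - F 0 x = (t - x) * F (Suc 0) \<xi>"
      using MVT2[of x t "F 0" "F (Suc 0)"] Suc.prems by force
    moreover have "F 0 x = 0" using Suc.prems by simp
    ultimately have "F 0 t = (t - x) * F (Suc 0) \<xi>" by (simp add: algebra_simps)
    thus ?thesis using \<open>x < \<xi>\<close> \<open>\<xi> < t\<close> Suc.prems(4,5)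
      by (intro bexI[of _ \<xi>]) (auto simp: abs_mult)
  next
    case equal
    then show ?thesis using Suc.prems by (intro bexI[of _ x]) auto
  qed
  then obtain \<xi> where xi: "\<xi> \<in> {a..b}" "\<bar>\<xi> - x\<bar> \<le> \<bar>t - x\<bar>"
      "\<bar>F 0 t\<bar> = \<bar>t - x\<bar> * \<bar>F (Suc 0) \<xi>\<bar>" by blast
  have "\<bar>F (Suc 0) \<xi>\<bar> \<le> M * \<bar>\<xi> - x\<bar> ^ k"
    by (rule Suc.IH[of "\<lambda>j. F (Suc j)"]) (use Suc.prems xi in auto)
  also have "\<dots> \<le> M * \<bar>t - x\<bar> ^ k"
    using M xi(2) by (intro mult_left_mono power_mono) auto
  finally show ?case unfolding xi(3)
    using mult_left_mono[of "\<bar>F (Suc 0) \<xi>\<bar>" "M * \<bar>t - x\<bar> ^ k" "\<bar>t - x\<bar>"] by (simp add: mult_ac)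
qed

section \<open>Orthonormal frames\<close>

definition orthonormal_frame :: "(nat \<Rightarrow> real ^ 'n) \<Rightarrow> bool" where
  "orthonormal_frame u \<longleftrightarrow>
     (\<forall>i\<in>{1..CARD('n)}. \<forall>j\<in>{1..CARD('n)}. u i \<bullet> u j = (if i = j then 1 else 0))"

lemma unit_vector_orthogonal_to_few:
  fixes S :: "(real ^ 'n) set"
  assumes "finite S" and "card S < CARD('n)"
  obtains x where "norm x = 1" and "\<And>y. y \<in> S \<Longrightarrow> x \<bullet> y = 0"
proof -
  have "dim S < DIM(real ^ 'n)" using dim_le_card[OF span_superset assms(1)] assms(2) by simp
  then obtain x where x: "x \<noteq> 0" "\<And>y. y \<in> span S \<Longrightarrow> orthogonal x y"
    using orthogonal_to_subspace_exists by blast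
  show thesis
    by (rule that[of "x /\<^sub>R norm x"]) (use x span_base in \<open>auto simp: orthogonal_def\<close>)
qed

text \<open>The Gram--Schmidt frame of the flag spanned by \<open>g 1, g 2, \<dots>\<close>, constructed from the other end:
  the vectors are chosen from \<open>u n\<close> downwards, and \<open>u i\<close> has to be orthogonal to the
  \<open>i - 1\<close> vectors \<open>g 1, \<dots>, g (i - 1)\<close> and to the \<open>n - i\<close> vectors already chosen, \<open>n - 1\<close> in all.\<close>

lemma adapted_frame:
  fixes g :: "nat \<Rightarrow> real ^ 'n"
  obtains u where "orthonormal_frame u"
    and "\<And>i k. i \<in> {1..CARD('n)} \<Longrightarrow> 1 \<le> k \<Longrightarrow> k < i \<Longrightarrow> g k \<bullet> u i = 0"
proof -
  let ?n = "CARD('n)"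
  have "\<exists>u. (\<forall>i\<in>{?n - m<..?n}. \<forall>j\<in>{?n - m<..?n}. u i \<bullet> u j = (if i = j then 1 else 0)) \<and>
      (\<forall>i\<in>{?n - m<..?n}. \<forall>k\<in>{1..<i}. g k \<bullet> u i = 0)" if "m \<le> ?n" for m
    using that
  proof (induction m)
    case 0
    then show ?case by simp
  next
    case (Suc m)
    from Suc.IH[OF Suc_leD[OF Suc.prems]] obtain u where u:
      "\<forall>i\<in>{?n - m<..?n}. \<forall>j\<in>{?n - m<..?n}. u i \<bullet> u j = (if i = j then 1 else 0)"
      "\<forall>i\<in>{?n - m<..?n}. \<forall>k\<in>{1..<i}. g k \<bullet> u i = 0"
      by (elim exE conjE) (rule that)
    let ?p = "?n - m"
    have p: "{?n - Suc m<..?n} = insert ?p {?p<..?n}" using Suc.prems by auto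
    have "card (g ` {1..<?p} \<union> u ` {?p<..?n}) \<le> card {1..<?p} + card {?p<..?n}"
      by (intro order.trans[OF card_Un_le] add_mono card_image_le) auto
    also have "\<dots> < ?n" using Suc.prems by simp
    finally obtain v where v: "norm v = 1" "\<And>y. y \<in> g ` {1..<?p} \<union> u ` {?p<..?n} \<Longrightarrow> v \<bullet> y = 0"
      using unit_vector_orthogonal_to_few[of "g ` {1..<?p} \<union> u ` {?p<..?n}"] by auto
    have vv: "v \<bullet> v = 1" using v(1) by (simp add: norm_eq_1)
    have uv: "u j \<bullet> v = 0" "v \<bullet> u j = 0" if "j \<in> {?p<..?n}" for j
      using v(2)[of "u j"] that by (simp_all add: inner_commute)
    have gv: "g k \<bullet> v = 0" if "k \<in> {1..<?p}" for k
      using v(2)[of "g k"] that by (simp add: inner_commute)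
    show ?case unfolding p
    proof (intro exI[of _ "u(?p := v)"] conjI ballI)
      fix i j assume "i \<in> insert ?p {?p<..?n}" "j \<in> insert ?p {?p<..?n}"
      thus "(u(?p := v)) i \<bullet> (u(?p := v)) j = (if i = j then 1 else 0)"
        using u(1) vv uv by (cases "i = ?p"; cases "j = ?p") simp_all
    next
      fix i k assume "i \<in> insert ?p {?p<..?n}" "k \<in> {1..<i}"
      thus "g k \<bullet> (u(?p := v)) i = 0"
        using u(2) gv by (cases "i = ?p") simp_all
    qed
  qed
  from this[OF order.refl] obtain u where
    "\<forall>i\<in>{?n - ?n<..?n}. \<forall>j\<in>{?n - ?n<..?n}. u i \<bullet> u j = (if i = j then 1 else 0)"
    "\<forall>i\<in>{?n - ?n<..?n}. \<forall>k\<in>{1..<i}. g k \<bullet> u i = 0"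
    by (elim exE conjE) (rule that)
  thus thesis by (intro that[of u]) (simp_all add: orthonormal_frame_def)
qed

lemma norm_le_sum_frame_coordinates:
  fixes v :: "real ^ 'n"
  assumes "orthonormal_frame u"
  shows "norm v \<le> (\<Sum>i=1..CARD('n). \<bar>v \<bullet> u i\<bar>)"
proof -
  let ?n = "CARD('n)"
  have u: "u i \<bullet> u j = (if i = j then 1 else 0)" if "i \<in> {1..?n}" "j \<in> {1..?n}" for i j
    using assms that by (auto simp: orthonormal_frame_def)
  have n1: "norm (u i) = 1" if "i \<in> {1..?n}" for i using u[OF that that] by (simp add: norm_eq_1)
  have inj: "inj_on u {1..?n}" by (rule inj_onI) (metis u zero_neq_one)
  have orth: "pairwise orthogonal (u ` {1..?n})"
    by (auto simp: pairwise_def orthogonal_def u)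
  have "0 \<notin> u ` {1..?n}" using n1 by force
  hence "independent (u ` {1..?n})" using orth by (rule pairwise_orthogonal_independent[rotated])
  hence "UNIV \<subseteq> span (u ` {1..?n})"
    using card_image[OF inj] by (intro card_ge_dim_independent) simp_all
  hence "(\<Sum>w\<in>u ` {1..?n}. (v \<bullet> w) *\<^sub>R w) = v"
    by (intro orthonormal_basis_expand[OF orth]) (use n1 in auto)
  hence "v = (\<Sum>i=1..?n. (v \<bullet> u i) *\<^sub>R u i)" using sum.reindex[OF inj, of "\<lambda>w. (v \<bullet> w) *\<^sub>R w"] by simp
  hence "norm v \<le> (\<Sum>i=1..?n. norm ((v \<bullet> u i) *\<^sub>R u i))" using norm_sum by metis
  also have "\<dots> = (\<Sum>i=1..?n. \<bar>v \<bullet> u i\<bar>)" using n1 by (intro sum.cong) auto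
  finally show ?thesis .
qed

section \<open>Curves, boxes and slabs\<close>

text \<open>The span of \<open>G 1, \<dots>, G i\<close> at \<open>t\<close> has dimension \<open>i\<close>, too large to lie in the span of
  \<open>u 1, \<dots>, u (i - 1)\<close>; so some \<open>G k\<close> has a component along one of \<open>u i, \<dots>, u n\<close>. For a bound that
  is uniform in \<open>t\<close> and in the frame, compactness is used only for the map
  \<open>(t, x) \<mapsto> \<Sum>\<^sub>j x\<^sub>j G (idx j) t\<close> on \<open>K\<close> times the unit sphere, where it is bounded below by some
  \<open>c > 0\<close>. For a given frame, \<open>n - 1\<close> linear conditions on \<open>x\<close> force the combination to involve only
  \<open>G 1, \<dots>, G i\<close> and to be orthogonal to \<open>u 1, \<dots>, u (i - 1)\<close>; its length, at least \<open>c\<close>, must then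
  come from the remaining coordinates.\<close>

lemma derivatives_not_orthogonal_to_tail:
  fixes G :: "nat \<Rightarrow> real \<Rightarrow> real ^ 'n" and idx :: "'n \<Rightarrow> nat"
  assumes idx: "bij_betw idx UNIV {1..CARD('n)}" and "compact K"
    and cont: "\<And>k. k \<in> {1..CARD('n)} \<Longrightarrow> continuous_on K (G k)"
    and det: "\<And>t. t \<in> K \<Longrightarrow> det ((\<chi> i j. G (idx j) t $ i) :: real ^ 'n ^ 'n) \<noteq> 0"
  obtains c where "0 < c"
    and "\<And>t u i. t \<in> K \<Longrightarrow> orthonormal_frame u \<Longrightarrow> i \<in> {1..CARD('n)} \<Longrightarrow>
           \<exists>k\<in>{1..i}. \<exists>m\<in>{i..CARD('n)}. c \<le> \<bar>G k t \<bullet> u m\<bar>"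
proof -
  let ?n = "CARD('n)"
  have idx_range: "idx j \<in> {1..?n}" for j using idx by (auto simp: bij_betw_def)
  define L where "L t x = (\<Sum>j\<in>UNIV. x $ j *\<^sub>R G (idx j) t)" for t and x :: "real ^ 'n"
  have L_nz: "L t x \<noteq> 0" if "t \<in> K" "x \<noteq> 0" for t x
  proof -
    let ?A = "(\<chi> i j. G (idx j) t $ i) :: real ^ 'n ^ 'n"
    have "?A *v x = L t x"
      by (simp add: L_def vec_eq_iff matrix_vector_mult_def mult.commute)
    moreover have "\<exists>B. B ** ?A = mat 1"
      using det[OF that(1)] by (auto simp: invertible_det_nz[symmetric] invertible_def)
    ultimately show ?thesis using that(2) matrix_left_invertible_ker[of ?A] by metis
  qed
  obtain c where "0 < c" and c: "\<And>t x. t \<in> K \<Longrightarrow> norm x = 1 \<Longrightarrow> c \<le> norm (L t x)"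
  proof (cases "K = {}")
    case True
    thus ?thesis using that[of 1] by simp
  next
    case False
    let ?S = "K \<times> sphere (0 :: real ^ 'n) 1"
    have "compact ?S" using \<open>compact K\<close> by (intro compact_Times) auto
    moreover have "?S \<noteq> {}" using False by simp
    moreover have "continuous_on ?S (\<lambda>y. norm (L (fst y) (snd y)))"
      unfolding L_def using idx_range
      by (intro continuous_intros continuous_on_compose2[OF cont]) auto
    ultimately obtain y where y: "y \<in> ?S" "\<forall>z\<in>?S. norm (L (fst y) (snd y)) \<le> norm (L (fst z) (snd z))"
      using continuous_attains_inf by blast
    show ?thesis
    proof (rule that)
      have "fst y \<in> K" "snd y \<noteq> 0" using y(1) by auto
      thus "0 < norm (L (fst y) (snd y))" using L_nz by simp
      show "norm (L (fst y) (snd y)) \<le> norm (L t x)" if "t \<in> K" "norm x = 1" for t x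
        using y(2) that by (auto dest: bspec[of _ _ "(t, x)"])
    qed
  qed
  \<comment> \<open>One factor \<open>n\<close> for the coordinates of \<open>L t x\<close>, one for the terms of each coordinate, and the
    factor \<open>2\<close> for a strict inequality.\<close>
  define e where "e = c / (2 * (real ?n * real ?n))"
  have e: "0 < e" "real ?n * (real ?n * e) < c" using \<open>0 < c\<close> by (simp_all add: e_def field_simps)
  have "\<exists>k\<in>{1..i}. \<exists>m\<in>{i..?n}. e \<le> \<bar>G k t \<bullet> u m\<bar>"
    if t: "t \<in> K" and u: "orthonormal_frame u" and i: "i \<in> {1..?n}" for t u i
  proof (rule ccontr)
    assume "\<not> ?thesis"
    hence small: "\<bar>G k t \<bullet> u m\<bar> \<le> e" if "k \<in> {1..i}" "m \<in> {i..?n}" for k m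
      using that by force
    \<comment> \<open>Orthogonality of \<open>x\<close> to \<open>?X\<close> removes the derivatives of order above \<open>i\<close>; orthogonality to
      \<open>?Y\<close> makes \<open>L t x\<close> orthogonal to \<open>u 1, \<dots>, u (i - 1)\<close>.\<close>
    let ?X = "(\<lambda>j. axis j 1) ` {j. i < idx j}"
    let ?Y = "(\<lambda>m. \<chi> j. G (idx j) t \<bullet> u m) ` {1..<i}"
    have "card {j. i < idx j} = card (idx ` {j. i < idx j})"
      using idx by (intro card_image[symmetric]) (auto simp: bij_betw_def inj_on_def)
    also have "\<dots> \<le> card {i<..?n}" using idx_range by (intro card_mono) auto
    finally have "card {j. i < idx j} \<le> ?n - i" by simp
    moreover have "card (?X \<union> ?Y) \<le> card {j. i < idx j} + card {1..<i}"
      by (intro order.trans[OF card_Un_le] add_mono card_image_le) auto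
    ultimately have "card (?X \<union> ?Y) < ?n"
      using i unfolding card_atLeastLessThan atLeastAtMost_iff by linarith
    then obtain x where x: "norm x = 1" "\<And>y. y \<in> ?X \<union> ?Y \<Longrightarrow> x \<bullet> y = 0"
      using unit_vector_orthogonal_to_few[of "?X \<union> ?Y"] by auto
    have high: "x $ j = 0" if "i < idx j" for j
      using x(2)[of "axis j 1"] that by (auto simp: inner_axis)
    have Lu: "L t x \<bullet> u m = (\<Sum>j\<in>UNIV. x $ j * (G (idx j) t \<bullet> u m))" for m
      by (simp add: L_def inner_sum_left)
    have Lx: "L t x \<bullet> u m = x \<bullet> (\<chi> j. G (idx j) t \<bullet> u m)" for m
      unfolding Lu by (simp add: inner_vec_def)
    have bound: "\<bar>L t x \<bullet> u m\<bar> \<le> real ?n * e" if m: "m \<in> {1..?n}" for m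
    proof (cases "m < i")
      case True
      hence "x \<bullet> (\<chi> j. G (idx j) t \<bullet> u m) = 0" using m by (intro x(2)) auto
      thus ?thesis using e(1) by (simp add: Lx)
    next
      case False
      have "\<bar>x $ j * (G (idx j) t \<bullet> u m)\<bar> \<le> e" for j
      proof (cases "i < idx j")
        case True
        thus ?thesis using high e(1) by simp
      next
        case False
        hence "\<bar>G (idx j) t \<bullet> u m\<bar> \<le> e" using small idx_range[of j] m \<open>\<not> m < i\<close> by simp
        moreover have "\<bar>x $ j\<bar> \<le> 1" using component_le_norm_cart[of x j] x(1) by simp
        ultimately show ?thesis using mult_mono[of "\<bar>x $ j\<bar>" 1] by (simp add: abs_mult)
      qed
      hence "(\<Sum>j\<in>UNIV. \<bar>x $ j * (G (idx j) t \<bullet> u m)\<bar>) \<le> real ?n * e"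
        using sum_bounded_above[of UNIV "\<lambda>j. \<bar>x $ j * (G (idx j) t \<bullet> u m)\<bar>" e] by simp
      thus ?thesis unfolding Lu by (rule order.trans[OF sum_abs])
    qed
    have "norm (L t x) \<le> (\<Sum>m=1..?n. \<bar>L t x \<bullet> u m\<bar>)"
      by (rule norm_le_sum_frame_coordinates[OF u])
    also have "\<dots> \<le> real ?n * (real ?n * e)"
      using sum_bounded_above[of "{1..?n}" "\<lambda>m. \<bar>L t x \<bullet> u m\<bar>" "real ?n * e"] bound by simp
    also have "\<dots> < c" by (rule e(2))
    finally show False using c[OF t x(1)] by simp
  qed
  thus thesis using that e(1) by blast
qed

text \<open>The conditional makes \<open>G 0\<close>, recentred at \<open>p\<close>, and its derivatives one sequence of functions, the
  form in which the one-variable estimates take them.\<close>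

lemma frame_coordinate_derivatives:
  fixes G :: "nat \<Rightarrow> real \<Rightarrow> 'a::real_inner"
  assumes "(G j has_vector_derivative G (Suc j) t) (at t)"
  shows "((\<lambda>t. (G j t - (if j = 0 then p else 0)) \<bullet> w) has_real_derivative
           (G (Suc j) t - (if Suc j = 0 then p else 0)) \<bullet> w) (at t)"
proof -
  have "((\<lambda>t. G j t - (if j = 0 then p else 0)) has_vector_derivative G (Suc j) t - 0) (at t)"
    by (intro has_vector_derivative_diff assms has_vector_derivative_const)
  from bounded_linear.has_vector_derivative[OF bounded_linear_inner_left this, of w]
  show ?thesis by (simp add: has_real_derivative_iff_has_vector_derivative)
qed

text \<open>In the frame adapted to the derivatives at \<open>x\<close>, the \<open>i\<close>-th coordinate of the curve vanishes to
  order \<open>i\<close> there, so over an interval of length comparable to \<open>\<rho>\<close> it is of size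
  \<open>\<rho> ^ i \<le> \<delta> i\<close>. The box with side lengths exactly \<open>\<delta>\<close> in this frame therefore contains the arc.\<close>

lemma short_arc_in_admissible_box:
  fixes G :: "nat \<Rightarrow> real \<Rightarrow> real ^ 'n"
  assumes deriv: "\<And>j t. j < CARD('n) \<Longrightarrow> t \<in> {a..b} \<Longrightarrow>
             (G j has_vector_derivative G (Suc j) t) (at t)"
    and bound: "\<And>k t. k \<in> {1..CARD('n)} \<Longrightarrow> t \<in> {a..b} \<Longrightarrow> norm (G k t) \<le> M"
    and "0 \<le> \<kappa>" "\<kappa> \<le> 1" "M * \<kappa> < 1 / 2" "0 < \<rho>" "x \<in> {a..b}"
    and "\<delta> \<in> Delta CARD('n)" and \<rho>: "\<And>i. i \<in> {1..CARD('n)} \<Longrightarrow> \<rho> ^ i \<le> \<delta> i"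
  obtains B where "admissible_box \<delta> B"
    and "G 0 ` ({a..b} \<inter> {x - \<kappa> * \<rho>..x + \<kappa> * \<rho>}) \<subseteq> B"
proof -
  let ?n = "CARD('n)"
  obtain u where u: "orthonormal_frame u"
    and flag: "\<And>i k. i \<in> {1..?n} \<Longrightarrow> 1 \<le> k \<Longrightarrow> k < i \<Longrightarrow> G k x \<bullet> u i = 0"
    using adapted_frame[of "\<lambda>k. G k x"] by blast
  define B where "B = {y. \<forall>i\<in>{1..?n}. \<bar>(y - G 0 x) \<bullet> u i\<bar> < \<delta> i / 2}"
  have "open_box_with_sides B \<delta>"
    using assms(8) u unfolding open_box_with_sides_def B_def Delta_def orthonormal_frame_def by blast
  hence "admissible_box \<delta> B" unfolding admissible_box_def by blast
  moreover have "\<bar>(G 0 t - G 0 x) \<bullet> u i\<bar> < \<delta> i / 2"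
    if t: "t \<in> {a..b}" "t \<in> {x - \<kappa> * \<rho>..x + \<kappa> * \<rho>}" and i: "i \<in> {1..?n}" for t i
  proof -
    define F where "F j t = (G j t - (if j = 0 then G 0 x else 0)) \<bullet> u i" for j t
    have "norm (u i) = 1" using u i by (auto simp: orthonormal_frame_def norm_eq_1)
    hence top: "\<bar>F i y\<bar> \<le> M" if "y \<in> {a..b}" for y
      using Cauchy_Schwarz_ineq2[of "G i y" "u i"] bound[OF i that] i by (simp add: F_def)
    have M: "0 \<le> M" using top[OF assms(7)] by linarith
    have "\<bar>F 0 t\<bar> \<le> M * \<bar>t - x\<bar> ^ i"
    proof (rule vanishing_derivatives_bound[where a = a and b = b])
      show "(F j has_real_derivative F (Suc j) y) (at y)" if "j < i" "y \<in> {a..b}" for j y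
        unfolding F_def using that i by (intro frame_coordinate_derivatives deriv) auto
      show "F j x = 0" if "j < i" for j
        using flag[OF i, of j] that by (cases "j = 0") (auto simp: F_def)
    qed (use top t assms(7) in auto)
    also have "\<dots> \<le> M * (\<kappa> * \<rho>) ^ i"
      using M t by (intro mult_left_mono power_mono) auto
    also have "\<dots> \<le> M * (\<kappa> * \<rho> ^ i)"
    proof -
      have "\<kappa> ^ i \<le> \<kappa> ^ 1" using i assms(3,4) by (intro power_decreasing) auto
      thus ?thesis using M assms(6) by (simp add: power_mult_distrib mult_left_mono mult_right_mono)
    qed
    also have "\<dots> < 1 / 2 * \<rho> ^ i"
      using mult_strict_right_mono[OF assms(5), of "\<rho> ^ i"] assms(6) by (simp add: mult.assoc)
    also have "\<dots> \<le> \<delta> i / 2" using \<rho>[OF i] by simp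
    finally show ?thesis by (simp add: F_def)
  qed
  ultimately show thesis by (intro that[of B]) (auto simp: B_def)
qed

text \<open>A slab that is thin in the \<open>n - i + 1\<close> directions \<open>u i, \<dots>, u n\<close> meets the curve in a parameter set
  that is covered by boundedly many intervals of length comparable to \<open>\<rho>\<close>. Near each parameter
  some coordinate in these directions has a derivative of order \<open>k \<le> i\<close> bounded away from \<open>0\<close>, and
  its sublevel set at height \<open>\<rho> ^ i\<close> has scale \<open>\<rho> ^ (i / k) \<le> \<rho>\<close>. The constants depend neither on the
  frame nor on the position of the slab.\<close>

lemma slab_preimage_net:
  fixes G :: "nat \<Rightarrow> real \<Rightarrow> real ^ 'n" and idx :: "'n \<Rightarrow> nat"
  assumes idx: "bij_betw idx UNIV {1..CARD('n)}"
    and deriv: "\<And>j t. j < CARD('n) \<Longrightarrow> t \<in> {a..b} \<Longrightarrow>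
             (G j has_vector_derivative G (Suc j) t) (at t)"
    and cont: "\<And>k. k \<in> {1..CARD('n)} \<Longrightarrow> continuous_on {a..b} (G k)"
    and det: "\<And>t. t \<in> {a..b} \<Longrightarrow> det ((\<chi> i j. G (idx j) t $ i) :: real ^ 'n ^ 'n) \<noteq> 0"
  obtains A :: real and q :: nat where "0 < A" "0 < q"
    and "\<And>u p i \<rho> S. orthonormal_frame u \<Longrightarrow> i \<in> {1..CARD('n)} \<Longrightarrow> 0 < \<rho> \<Longrightarrow> \<rho> \<le> 1 \<Longrightarrow> S \<subseteq> {a..b} \<Longrightarrow>
       (\<forall>t\<in>S. \<forall>m\<in>{i..CARD('n)}. \<bar>(G 0 t - p) \<bullet> u m\<bar> \<le> \<rho> ^ i) \<Longrightarrow>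
       \<exists>P. finite P \<and> P \<subseteq> S \<and> card P \<le> q \<and> S \<subseteq> (\<Union>x\<in>P. {x - A * \<rho>..x + A * \<rho>})"
proof -
  let ?n = "CARD('n)"
  obtain c where "0 < c" and c: "\<And>t u i. t \<in> {a..b} \<Longrightarrow> orthonormal_frame u \<Longrightarrow> i \<in> {1..?n} \<Longrightarrow>
           \<exists>k\<in>{1..i}. \<exists>m\<in>{i..?n}. c \<le> \<bar>G k t \<bullet> u m\<bar>"
    using derivatives_not_orthogonal_to_tail[OF idx compact_Icc cont det] by metis
  have "\<exists>\<eta>>0. \<forall>t\<in>{a..b}. \<forall>z\<in>{a..b}. dist t z < \<eta> \<longrightarrow> dist (G k t) (G k z) < c / 2"
    if "k \<in> {1..?n}" for k
    using compact_uniformly_continuous[OF cont[OF that] compact_Icc] \<open>0 < c\<close>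
    unfolding uniformly_continuous_on_def by (metis dist_commute half_gt_zero)
  then obtain h where h: "\<And>k. k \<in> {1..?n} \<Longrightarrow> 0 < h k"
    "\<And>k t z. k \<in> {1..?n} \<Longrightarrow> t \<in> {a..b} \<Longrightarrow> z \<in> {a..b} \<Longrightarrow> dist t z < h k \<Longrightarrow> dist (G k t) (G k z) < c / 2"
    by metis
  define \<eta> where "\<eta> = Min (h ` {1..?n})"
  have \<eta>: "0 < \<eta>" "\<And>k. k \<in> {1..?n} \<Longrightarrow> \<eta> \<le> h k"
    using h(1) by (auto simp: \<eta>_def)
  obtain Z where Z: "finite Z" "Z \<subseteq> {a..b}" "{a..b} \<subseteq> (\<Union>z\<in>Z. ball z \<eta>)"
    using seq_compact_imp_totally_bounded[of "{a..b}"] \<eta>(1)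
    by (metis compact_Icc compact_imp_seq_compact)
  \<comment> \<open>\<open>A \<ge> 2\<close> makes \<open>(2 / A) ^ k\<close> at most \<open>2 / A\<close> for all \<open>k \<ge> 1\<close> at once, and this is below the
    bound \<open>c / 2\<close> for the derivative.\<close>
  define A where "A = 2 + 4 / c"
  have A: "2 \<le> A" "2 / A < c / 2" using \<open>0 < c\<close> by (simp_all add: A_def field_simps add_pos_pos)
  \<comment> \<open>The successor keeps \<open>q\<close> positive when \<open>{a..b}\<close>, and with it \<open>Z\<close>, is empty.\<close>
  define q where "q = Suc (card Z * 2 ^ ?n)"
  have "\<exists>P. finite P \<and> P \<subseteq> S \<and> card P \<le> q \<and> S \<subseteq> (\<Union>x\<in>P. {x - A * \<rho>..x + A * \<rho>})"
    if u: "orthonormal_frame u" and i: "i \<in> {1..?n}" and \<rho>: "0 < \<rho>" "\<rho> \<le> 1" and S: "S \<subseteq> {a..b}"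
      and slab: "\<forall>t\<in>S. \<forall>m\<in>{i..?n}. \<bar>(G 0 t - p) \<bullet> u m\<bar> \<le> \<rho> ^ i" for u p i \<rho> S
  proof -
    have r: "0 < A * \<rho>" using A \<rho> by simp
    have "\<exists>P. finite P \<and> P \<subseteq> S \<inter> ball z \<eta> \<and> card P \<le> 2 ^ ?n \<and>
        S \<inter> ball z \<eta> \<subseteq> (\<Union>x\<in>P. {x - A * \<rho>..x + A * \<rho>})" if z: "z \<in> Z" for z
    proof -
      obtain k m where k: "k \<in> {1..i}" and m: "m \<in> {i..?n}" and km: "c \<le> \<bar>G k z \<bullet> u m\<bar>"
        using c[of z u i] z Z(2) u i by blast
      have kn: "k \<in> {1..?n}" and mn: "m \<in> {1..?n}" using k m i by auto
      have um: "norm (u m) = 1" using u mn by (auto simp: orthonormal_frame_def norm_eq_1)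
      obtain P where P: "finite P" "P \<subseteq> S \<inter> ball z \<eta>"
          "\<And>x y. x \<in> P \<Longrightarrow> y \<in> P \<Longrightarrow> x \<noteq> y \<Longrightarrow> A * \<rho> \<le> \<bar>x - y\<bar>"
          "S \<inter> ball z \<eta> \<subseteq> (\<Union>x\<in>P. {x - A * \<rho>..x + A * \<rho>})"
        by (rule maximal_separated_subset[OF le_infI1[OF S] r]) (rule that)
      define F where "F j t = (G j t - (if j = 0 then p else 0)) \<bullet> u m" for j t
      have "card P < 2 ^ k"
      proof (rule sublevel_separated_card[where F = F and \<epsilon> = "\<rho> ^ i" and r = "A * \<rho>"
            and J = "{a..b} \<inter> ball z \<eta>"])
        show "is_interval ({a..b} \<inter> ball z \<eta>)"
          by (intro is_interval_Int is_interval_cc is_interval_ball_real)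
        show "(F j has_real_derivative F (Suc j) t) (at t)"
          if "j < k" "t \<in> {a..b} \<inter> ball z \<eta>" for j t
          unfolding F_def using that kn by (intro frame_coordinate_derivatives deriv) auto
        show "\<bar>F 0 x\<bar> \<le> \<rho> ^ i" if "x \<in> P" for x
          using slab m P(2) that by (auto simp: F_def)
        fix t assume t: "t \<in> {a..b} \<inter> ball z \<eta>"
        have "dist t z < h k" using t \<eta>(2)[OF kn] by (simp add: dist_commute)
        hence "dist (G k t) (G k z) < c / 2" using h(2)[OF kn, of t z] t z Z(2) by auto
        hence "\<bar>(G k t - G k z) \<bullet> u m\<bar> < c / 2"
          using Cauchy_Schwarz_ineq2[of "G k t - G k z" "u m"] um by (simp add: dist_norm)
        hence "c / 2 < \<bar>G k t \<bullet> u m\<bar>"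
          using km unfolding inner_diff_left by linarith
        hence large: "c / 2 < \<bar>F k t\<bar>" using k by (simp add: F_def)
        have "\<rho> ^ i * (2 / (A * \<rho>)) ^ k \<le> \<rho> ^ k * (2 / (A * \<rho>)) ^ k"
          using k \<rho> A by (intro mult_right_mono power_decreasing) auto
        also have "\<dots> = (2 / A) ^ k" using \<rho> by (simp flip: power_mult_distrib)
        also have "\<dots> \<le> (2 / A) ^ 1" using k A by (intro power_decreasing) auto
        also have "\<dots> < c / 2" using A by simp
        finally show "\<rho> ^ i * (2 / (A * \<rho>)) ^ k < \<bar>F k t\<bar>" using large by simp
      qed (use r P S in auto)
      also have "\<dots> \<le> 2 ^ ?n" using kn by (intro power_increasing) auto
      finally show ?thesis using P by (intro exI[of _ P]) auto
    qed
    hence "\<exists>P. \<forall>z\<in>Z. finite (P z) \<and> P z \<subseteq> S \<inter> ball z \<eta> \<and> card (P z) \<le> 2 ^ ?n \<and>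
        S \<inter> ball z \<eta> \<subseteq> (\<Union>x\<in>P z. {x - A * \<rho>..x + A * \<rho>})"
      by (intro bchoice ballI)
    then obtain P where P: "\<And>z. z \<in> Z \<Longrightarrow> finite (P z)" "\<And>z. z \<in> Z \<Longrightarrow> P z \<subseteq> S \<inter> ball z \<eta>"
        "\<And>z. z \<in> Z \<Longrightarrow> card (P z) \<le> 2 ^ ?n"
        "\<And>z. z \<in> Z \<Longrightarrow> S \<inter> ball z \<eta> \<subseteq> (\<Union>x\<in>P z. {x - A * \<rho>..x + A * \<rho>})"
      by blast
    have "card (\<Union>z\<in>Z. P z) \<le> (\<Sum>z\<in>Z. card (P z))" by (rule card_UN_le[OF Z(1)])
    also have "\<dots> \<le> card Z * 2 ^ ?n" using P(3) sum_bounded_above[of Z "\<lambda>z. card (P z)" "2 ^ ?n"] by simp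
    finally have "card (\<Union>z\<in>Z. P z) \<le> q" by (simp add: q_def)
    moreover have "S \<subseteq> (\<Union>x\<in>(\<Union>z\<in>Z. P z). {x - A * \<rho>..x + A * \<rho>})"
    proof
      fix t assume "t \<in> S"
      then obtain z where "z \<in> Z" "t \<in> S \<inter> ball z \<eta>" using S Z(3) by blast
      thus "t \<in> (\<Union>x\<in>(\<Union>z\<in>Z. P z). {x - A * \<rho>..x + A * \<rho>})" using P(4) by blast
    qed
    moreover have "finite (\<Union>z\<in>Z. P z)" "(\<Union>z\<in>Z. P z) \<subseteq> S" using P(1,2) Z(1) by auto
    ultimately show ?thesis by (intro exI[of _ "\<Union>z\<in>Z. P z"] conjI)
  qed
  moreover have "0 < A" "0 < q" using A(1) by (simp_all add: q_def)
  ultimately show thesis by (intro that[of A q])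
qed

section \<open>Counting points of Ahlfors regular sets\<close>

text \<open>The measure of \<open>T\<close> is at least \<open>c\<close> times \<open>diameter T powr s\<close>, and each interval of the cover carries at most
  \<open>C * r powr s\<close>. The upper bound persists for \<open>r > diameter T\<close>, since the interval then carries
  no more than at scale \<open>diameter T\<close>.\<close>

lemma ahlfors_net_card_ge:
  assumes reg: "ahlfors_regular_with s c C T" and "0 < r" and P: "finite P" "P \<subseteq> T"
    and net: "T \<subseteq> (\<Union>x\<in>P. {x - r..x + r})"
  shows "c * diameter T powr s \<le> real (card P) * (C * r powr s)"
proof -
  let ?d = "diameter T"
  have T: "compact T" "0 < ?d" "0 < s" "0 < c" "c \<le> C"
    using reg by (auto simp: ahlfors_regular_with_def)
  obtain \<mu> :: "real measure" where \<mu>: "finite_measure \<mu>" "sets \<mu> = sets borel"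
    "\<And>t r. t \<in> T \<Longrightarrow> 0 < r \<Longrightarrow> r \<le> ?d \<Longrightarrow>
       c * r powr s \<le> measure \<mu> (T \<inter> {t - r..t + r}) \<and> measure \<mu> (T \<inter> {t - r..t + r}) \<le> C * r powr s"
    using reg unfolding ahlfors_regular_with_def by blast
  interpret finite_measure \<mu> by (rule \<mu>(1))
  have whole: "T \<inter> {t - r..t + r} = T" if "t \<in> T" "?d \<le> r" for t r
    using diameter_bounded_bound[OF compact_imp_bounded[OF T(1)] that(1)] that(2)
    by (force simp: dist_real_def)
  have sets: "T \<inter> {t - r..t + r} \<in> sets \<mu>" for t r
    using T(1) by (simp add: \<mu>(2) compact_imp_closed borel_closed sets.Int)
  have ball: "measure \<mu> (T \<inter> {t - r..t + r}) \<le> C * r powr s" if "t \<in> T" for t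
  proof (cases "r \<le> ?d")
    case True
    thus ?thesis using \<mu>(3) that \<open>0 < r\<close> by blast
  next
    case False
    have "measure \<mu> (T \<inter> {t - r..t + r}) \<le> C * ?d powr s"
      using \<mu>(3)[OF that T(2)] whole[OF that] False by simp
    also have "\<dots> \<le> C * r powr s"
      using False T by (intro mult_left_mono powr_mono2) auto
    finally show ?thesis .
  qed
  obtain t where t: "t \<in> T" using T(2) by (cases "T = {}") auto
  have "c * ?d powr s \<le> measure \<mu> T" using \<mu>(3)[OF t T(2)] whole[OF t] by simp
  also have "\<dots> = measure \<mu> (\<Union>x\<in>P. T \<inter> {x - r..x + r})"
    using net by (intro arg_cong[where f = "measure \<mu>"]) auto
  also have "\<dots> \<le> (\<Sum>x\<in>P. measure \<mu> (T \<inter> {x - r..x + r}))"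
    using sets by (intro finite_measure_subadditive_finite P(1)) auto
  also have "\<dots> \<le> (\<Sum>x\<in>P. C * r powr s)" using ball P by (intro sum_mono) auto
  finally show ?thesis by simp
qed

text \<open>The intervals of radius \<open>r / 3\<close> around the points of \<open>P\<close> are disjoint, and each carries a fixed share
  of the measure of \<open>T\<close>.\<close>

lemma ahlfors_separated_card_le:
  assumes reg: "ahlfors_regular_with s c C T" and "0 < r" "r \<le> diameter T" and P: "finite P" "P \<subseteq> T"
    and sep: "\<And>x y. x \<in> P \<Longrightarrow> y \<in> P \<Longrightarrow> x \<noteq> y \<Longrightarrow> r \<le> \<bar>x - y\<bar>"
  shows "real (card P) * (c * (r / 3) powr s) \<le> C * diameter T powr s"
proof -
  let ?d = "diameter T"
  have T: "compact T" "0 < ?d" using reg by (auto simp: ahlfors_regular_with_def)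
  obtain \<mu> :: "real measure" where \<mu>: "finite_measure \<mu>" "sets \<mu> = sets borel"
    "\<And>t r. t \<in> T \<Longrightarrow> 0 < r \<Longrightarrow> r \<le> ?d \<Longrightarrow>
       c * r powr s \<le> measure \<mu> (T \<inter> {t - r..t + r}) \<and> measure \<mu> (T \<inter> {t - r..t + r}) \<le> C * r powr s"
    using reg unfolding ahlfors_regular_with_def by blast
  interpret finite_measure \<mu> by (rule \<mu>(1))
  have whole: "T \<inter> {t - ?d..t + ?d} = T" if "t \<in> T" for t
    using diameter_bounded_bound[OF compact_imp_bounded[OF T(1)] that]
    by (force simp: dist_real_def)
  have sets: "T \<inter> {t - r..t + r} \<in> sets \<mu>" for t r
    using T(1) by (simp add: \<mu>(2) compact_imp_closed borel_closed sets.Int)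
  have disj: "disjoint_family_on (\<lambda>x. T \<inter> {x - r / 3..x + r / 3}) P"
    unfolding disjoint_family_on_def
  proof (intro ballI impI)
    fix x y assume "x \<in> P" "y \<in> P" "x \<noteq> y"
    hence "r \<le> \<bar>x - y\<bar>" by (rule sep)
    thus "(T \<inter> {x - r / 3..x + r / 3}) \<inter> (T \<inter> {y - r / 3..y + r / 3}) = {}"
      using \<open>0 < r\<close> by auto
  qed
  obtain t where t: "t \<in> T" using T(2) by (cases "T = {}") auto
  have "real (card P) * (c * (r / 3) powr s) = (\<Sum>x\<in>P. c * (r / 3) powr s)" by simp
  also have "\<dots> \<le> (\<Sum>x\<in>P. measure \<mu> (T \<inter> {x - r / 3..x + r / 3}))"
    using \<mu>(3)[of _ "r / 3"] P(2) assms(2,3) by (intro sum_mono) auto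
  also have "\<dots> = measure \<mu> (\<Union>x\<in>P. T \<inter> {x - r / 3..x + r / 3})"
    using sets disj P(1) by (intro finite_measure_finite_Union[symmetric]) auto
  also have "\<dots> \<le> measure \<mu> T"
    using T(1) by (intro finite_measure_mono) (auto simp: \<mu>(2) compact_imp_closed borel_closed)
  also have "\<dots> \<le> C * ?d powr s" using \<mu>(3)[OF t T(2)] whole[OF t] by simp
  finally show ?thesis .
qed

section \<open>Covering numbers\<close>

text \<open>This describes \<open>\<rho>\<close> without roots: it is the largest one with \<open>\<rho> ^ i \<le> \<delta> i\<close> for all
  \<open>i\<close>, so equality holds for some \<open>i\<close>.\<close>

lemma Delta_scale:
  fixes \<delta> :: "nat \<Rightarrow> real" and n :: nat
  defines "\<rho> \<equiv> MIN i\<in>{1..n}. \<delta> i powr (1 / real i)"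
  assumes \<delta>: "\<delta> \<in> Delta n" and "1 \<le> n"
  shows "0 < \<rho>" and "\<rho> \<le> 1" and "\<And>i. i \<in> {1..n} \<Longrightarrow> \<rho> ^ i \<le> \<delta> i"
    and "\<exists>i\<in>{1..n}. \<delta> i = \<rho> ^ i"
proof -
  let ?R = "(\<lambda>i. \<delta> i powr (1 / real i)) ` {1..n}"
  have fin: "finite ?R" "?R \<noteq> {}" using \<open>1 \<le> n\<close> by auto
  have pos: "0 < \<delta> i" "\<delta> i < 1" if "i \<in> {1..n}" for i using \<delta> that by (auto simp: Delta_def)
  have root: "(\<delta> i powr (1 / real i)) ^ i = \<delta> i" if "i \<in> {1..n}" for i
    using pos[OF that] that by (simp add: powr_powr flip: powr_realpow)
  obtain j where j: "j \<in> {1..n}" "\<rho> = \<delta> j powr (1 / real j)"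
    using Min_in[OF fin] unfolding \<rho>_def by auto
  show \<rho>0: "0 < \<rho>" using pos[OF j(1)] by (simp add: j(2))
  show "\<rho> \<le> 1" using pos[OF j(1)] by (simp add: j(2) powr_le1)
  show "\<exists>i\<in>{1..n}. \<delta> i = \<rho> ^ i" using j root by (intro bexI[of _ j]) auto
  fix i assume i: "i \<in> {1..n}"
  have "\<rho> \<le> \<delta> i powr (1 / real i)" unfolding \<rho>_def using i fin by (intro Min_le) auto
  hence "\<rho> ^ i \<le> (\<delta> i powr (1 / real i)) ^ i" using \<rho>0 by (intro power_mono) auto
  thus "\<rho> ^ i \<le> \<delta> i" using root[OF i] by simp
qed

text \<open>Since side lengths decrease, all of \<open>\<delta> i, \<dots>, \<delta> n\<close> are at most \<open>\<delta> i\<close>.\<close>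

lemma admissible_box_in_slab:
  fixes B :: "(real ^ 'n) set"
  assumes "admissible_box \<delta> B" and "\<delta> \<in> Delta CARD('n)" and "i \<in> {1..CARD('n)}"
  obtains u p where "orthonormal_frame u"
    and "\<And>y m. y \<in> B \<Longrightarrow> m \<in> {i..CARD('n)} \<Longrightarrow> \<bar>(y - p) \<bullet> u m\<bar> \<le> \<delta> i"
proof -
  let ?n = "CARD('n)"
  obtain l p u where l: "\<forall>i\<in>{1..?n}. l i \<le> \<delta> i" and u: "orthonormal_frame u"
      and B: "B = {x. \<forall>i\<in>{1..?n}. \<bar>(x - p) \<bullet> u i\<bar> < l i / 2}"
    using assms(1) unfolding admissible_box_def open_box_with_sides_def orthonormal_frame_def by blast
  show thesis
  proof (rule that[OF u])
    fix y m assume y: "y \<in> B" and "m \<in> {i..?n}"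
    hence m: "m \<in> {1..?n}" "i \<le> m" using assms(3) by auto
    have "\<bar>(y - p) \<bullet> u m\<bar> < l m / 2" using y m by (simp add: B)
    moreover have "l m \<le> \<delta> m" using l m by blast
    moreover have "\<delta> m \<le> \<delta> i" "0 < \<delta> i" using assms(2,3) m by (auto simp: Delta_def)
    ultimately show "\<bar>(y - p) \<bullet> u m\<bar> \<le> \<delta> i" by linarith
  qed
qed

text \<open>A maximal set of points of \<open>T\<close> separated by a small multiple of \<open>\<rho>\<close> has at most of the order of
  \<open>\<rho> powr (- s)\<close> elements, and the arc around each of them fits into one box.\<close>

lemma box_covering_upper:
  fixes G :: "nat \<Rightarrow> real \<Rightarrow> real ^ 'n"
  assumes deriv: "\<And>j t. j < CARD('n) \<Longrightarrow> t \<in> {a..b} \<Longrightarrow>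
             (G j has_vector_derivative G (Suc j) t) (at t)"
    and cont: "\<And>k. k \<in> {1..CARD('n)} \<Longrightarrow> continuous_on {a..b} (G k)"
    and pos: "0 < c" "0 < C" "0 < d"
  obtains K where "0 < K"
    and "\<And>T \<delta> \<rho>. T \<subseteq> {a..b} \<Longrightarrow> ahlfors_regular_with s c C T \<Longrightarrow> diameter T = d \<Longrightarrow>
      \<delta> \<in> Delta CARD('n) \<Longrightarrow> 0 < \<rho> \<Longrightarrow> \<rho> \<le> 1 \<Longrightarrow> (\<forall>i\<in>{1..CARD('n)}. \<rho> ^ i \<le> \<delta> i) \<Longrightarrow>
      \<exists>\<B>. finite \<B> \<and> (\<forall>B\<in>\<B>. admissible_box \<delta> B) \<and> G 0 ` T \<subseteq> \<Union>\<B> \<and>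
           real (card \<B>) \<le> K * \<rho> powr (- s)"
proof -
  let ?n = "CARD('n)"
  have "compact (\<Union>k\<in>{1..?n}. G k ` {a..b})"
    using cont by (intro compact_UN compact_continuous_image) auto
  from compact_imp_bounded[OF this, unfolded bounded_pos]
  obtain M where "0 < M" and M: "\<forall>v\<in>(\<Union>k\<in>{1..?n}. G k ` {a..b}). norm v \<le> M"
    by (elim exE conjE) (rule that)
  \<comment> \<open>\<open>\<kappa> \<le> d\<close> keeps \<open>\<kappa> * \<rho>\<close> in the range of scales where Ahlfors regularity applies.\<close>
  define \<kappa> where "\<kappa> = min (min 1 d) (1 / (2 * M + 1))"
  have \<kappa>: "0 < \<kappa>" "\<kappa> \<le> 1" "\<kappa> \<le> d" "\<kappa> \<le> 1 / (2 * M + 1)"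
    using \<open>0 < M\<close> \<open>0 < d\<close> by (auto simp: \<kappa>_def)
  have "M * \<kappa> \<le> M * (1 / (2 * M + 1))" using \<kappa> \<open>0 < M\<close> by (intro mult_left_mono) auto
  also have "\<dots> < 1 / 2" using \<open>0 < M\<close> by (simp add: field_simps)
  finally have M\<kappa>: "M * \<kappa> < 1 / 2" .
  define K where "K = C * d powr s / (c * (\<kappa> / 3) powr s)"
  have "0 < K" using pos \<kappa> by (simp add: K_def)
  moreover have "\<exists>\<B>. finite \<B> \<and> (\<forall>B\<in>\<B>. admissible_box \<delta> B) \<and> G 0 ` T \<subseteq> \<Union>\<B> \<and>
           real (card \<B>) \<le> K * \<rho> powr (- s)"
    if T: "T \<subseteq> {a..b}" "ahlfors_regular_with s c C T" "diameter T = d"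
      and \<delta>: "\<delta> \<in> Delta ?n" and \<rho>: "0 < \<rho>" "\<rho> \<le> 1" "\<forall>i\<in>{1..?n}. \<rho> ^ i \<le> \<delta> i" for T \<delta> \<rho>
  proof -
    have r: "0 < \<kappa> * \<rho>" using \<kappa> \<rho> by simp
    have "\<kappa> * \<rho> \<le> \<kappa> * 1" using \<kappa> \<rho> by (intro mult_left_mono) auto
    hence rd: "\<kappa> * \<rho> \<le> diameter T" using \<kappa>(3) T(3) by linarith
    obtain P where P: "finite P" "P \<subseteq> T"
        "\<And>x y. x \<in> P \<Longrightarrow> y \<in> P \<Longrightarrow> x \<noteq> y \<Longrightarrow> \<kappa> * \<rho> \<le> \<bar>x - y\<bar>"
        "T \<subseteq> (\<Union>x\<in>P. {x - \<kappa> * \<rho>..x + \<kappa> * \<rho>})"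
      by (rule maximal_separated_subset[OF T(1) r]) (rule that)
    have "\<exists>B. admissible_box \<delta> B \<and> G 0 ` ({a..b} \<inter> {x - \<kappa> * \<rho>..x + \<kappa> * \<rho>}) \<subseteq> B" if x: "x \<in> P" for x
    proof -
      have "x \<in> {a..b}" using x P(2) T(1) by blast
      thus ?thesis
        using short_arc_in_admissible_box[of a b G M \<kappa> \<rho> x \<delta>] deriv M \<kappa> M\<kappa> \<rho> \<delta> by fastforce
    qed
    then obtain B where B: "\<And>x. x \<in> P \<Longrightarrow> admissible_box \<delta> (B x)"
        "\<And>x. x \<in> P \<Longrightarrow> G 0 ` ({a..b} \<inter> {x - \<kappa> * \<rho>..x + \<kappa> * \<rho>}) \<subseteq> B x"
      by metis
    have cover: "G 0 ` T \<subseteq> \<Union>(B ` P)"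
    proof (rule image_subsetI)
      fix t assume "t \<in> T"
      then obtain x where "x \<in> P" "t \<in> {a..b} \<inter> {x - \<kappa> * \<rho>..x + \<kappa> * \<rho>}" using P(4) T(1) by blast
      thus "G 0 t \<in> \<Union>(B ` P)" using B(2) by blast
    qed
    have scale: "(\<kappa> * \<rho> / 3) powr s = (\<kappa> / 3) powr s * \<rho> powr s"
      using \<kappa> \<rho> powr_mult[of "\<kappa> / 3" \<rho> s] by simp
    have "0 < c * (\<kappa> * \<rho> / 3) powr s" using pos \<kappa> \<rho> by simp
    moreover have "real (card P) * (c * (\<kappa> * \<rho> / 3) powr s) \<le> C * d powr s"
      using ahlfors_separated_card_le[OF T(2) r rd P(1,2,3)] T(3) by simp
    ultimately have "real (card P) \<le> C * d powr s / (c * (\<kappa> * \<rho> / 3) powr s)"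
      by (simp only: pos_le_divide_eq)
    also have "\<dots> = K * \<rho> powr (- s)"
      by (simp add: K_def scale powr_minus divide_simps)
    finally have "real (card (B ` P)) \<le> K * \<rho> powr (- s)"
      using card_image_le[OF P(1), of B] by linarith
    thus ?thesis using B(1) P(1) cover by (intro exI[of _ "B ` P"]) auto
  qed
  ultimately show thesis by (rule that)
qed

text \<open>Each box of a cover contains the image of a part of \<open>T\<close> that has a net of at most \<open>q\<close> points at
  scale \<open>A * \<rho>\<close>. The union of these nets is a net of \<open>T\<close>, and a net of an Ahlfors regular set at that
  scale needs at least of the order of \<open>\<rho> powr (- s)\<close> points.\<close>

lemma box_covering_lower:
  fixes G :: "nat \<Rightarrow> real \<Rightarrow> real ^ 'n" and idx :: "'n \<Rightarrow> nat"
  assumes idx: "bij_betw idx UNIV {1..CARD('n)}"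
    and deriv: "\<And>j t. j < CARD('n) \<Longrightarrow> t \<in> {a..b} \<Longrightarrow>
             (G j has_vector_derivative G (Suc j) t) (at t)"
    and cont: "\<And>k. k \<in> {1..CARD('n)} \<Longrightarrow> continuous_on {a..b} (G k)"
    and det: "\<And>t. t \<in> {a..b} \<Longrightarrow> det ((\<chi> i j. G (idx j) t $ i) :: real ^ 'n ^ 'n) \<noteq> 0"
    and pos: "0 < c" "0 < C" "0 < d"
  obtains K where "0 < K"
    and "\<And>T \<delta> \<rho> i \<B>. T \<subseteq> {a..b} \<Longrightarrow> ahlfors_regular_with s c C T \<Longrightarrow> diameter T = d \<Longrightarrow>
      \<delta> \<in> Delta CARD('n) \<Longrightarrow> 0 < \<rho> \<Longrightarrow> \<rho> \<le> 1 \<Longrightarrow> i \<in> {1..CARD('n)} \<Longrightarrow> \<delta> i = \<rho> ^ i \<Longrightarrow>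
      finite \<B> \<Longrightarrow> (\<forall>B\<in>\<B>. admissible_box \<delta> B) \<Longrightarrow> G 0 ` T \<subseteq> \<Union>\<B> \<Longrightarrow>
      K * \<rho> powr (- s) \<le> real (card \<B>)"
proof -
  let ?n = "CARD('n)"
  obtain A :: real and q :: nat where Aq: "0 < A" "0 < q"
    and net: "\<And>u p i \<rho> S. orthonormal_frame u \<Longrightarrow> i \<in> {1..?n} \<Longrightarrow> 0 < \<rho> \<Longrightarrow> \<rho> \<le> 1 \<Longrightarrow> S \<subseteq> {a..b} \<Longrightarrow>
       (\<forall>t\<in>S. \<forall>m\<in>{i..?n}. \<bar>(G 0 t - p) \<bullet> u m\<bar> \<le> \<rho> ^ i) \<Longrightarrow>
       \<exists>P. finite P \<and> P \<subseteq> S \<and> card P \<le> q \<and> S \<subseteq> (\<Union>x\<in>P. {x - A * \<rho>..x + A * \<rho>})"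
    by (rule slab_preimage_net[OF idx deriv cont det]) (assumption+, rule that)
  define K where "K = c * d powr s / (real q * (C * A powr s))"
  have "0 < K" using pos Aq by (simp add: K_def)
  moreover have "K * \<rho> powr (- s) \<le> real (card \<B>)"
    if T: "T \<subseteq> {a..b}" "ahlfors_regular_with s c C T" "diameter T = d"
      and \<delta>: "\<delta> \<in> Delta ?n" and \<rho>: "0 < \<rho>" "\<rho> \<le> 1" and i: "i \<in> {1..?n}" "\<delta> i = \<rho> ^ i"
      and \<B>: "finite \<B>" "\<forall>B\<in>\<B>. admissible_box \<delta> B" "G 0 ` T \<subseteq> \<Union>\<B>" for T \<delta> \<rho> i \<B>
  proof -
    have r: "0 < A * \<rho>" using Aq \<rho> by simp
    have "\<exists>P. finite P \<and> P \<subseteq> T \<inter> G 0 -` B \<and> card P \<le> q \<and>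
        T \<inter> G 0 -` B \<subseteq> (\<Union>x\<in>P. {x - A * \<rho>..x + A * \<rho>})" if B: "B \<in> \<B>" for B
    proof -
      obtain u p where u: "orthonormal_frame u"
          and slab: "\<And>y m. y \<in> B \<Longrightarrow> m \<in> {i..?n} \<Longrightarrow> \<bar>(y - p) \<bullet> u m\<bar> \<le> \<delta> i"
        by (rule admissible_box_in_slab[OF \<B>(2)[rule_format, OF B] \<delta> i(1)]) (rule that)
      show ?thesis
        by (rule net[OF u i(1) \<rho>, where p = p]) (use slab T(1) i(2) in auto)
    qed
    hence "\<exists>P. \<forall>B\<in>\<B>. finite (P B) \<and> P B \<subseteq> T \<inter> G 0 -` B \<and> card (P B) \<le> q \<and>
        T \<inter> G 0 -` B \<subseteq> (\<Union>x\<in>P B. {x - A * \<rho>..x + A * \<rho>})"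
      by (intro bchoice ballI)
    then obtain P where P0: "\<forall>B\<in>\<B>. finite (P B) \<and> P B \<subseteq> T \<inter> G 0 -` B \<and> card (P B) \<le> q \<and>
        T \<inter> G 0 -` B \<subseteq> (\<Union>x\<in>P B. {x - A * \<rho>..x + A * \<rho>})" ..
    have P: "finite (P B)" "P B \<subseteq> T \<inter> G 0 -` B" "card (P B) \<le> q"
        "T \<inter> G 0 -` B \<subseteq> (\<Union>x\<in>P B. {x - A * \<rho>..x + A * \<rho>})" if "B \<in> \<B>" for B
      using bspec[OF P0 that] by simp_all
    let ?P = "\<Union>B\<in>\<B>. P B"
    have fin: "finite ?P" and sub: "?P \<subseteq> T" using P \<B>(1) by auto
    have cover: "T \<subseteq> (\<Union>x\<in>?P. {x - A * \<rho>..x + A * \<rho>})"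
    proof
      fix t assume "t \<in> T"
      then obtain B where B: "B \<in> \<B>" "t \<in> T \<inter> G 0 -` B" using \<B>(3) by blast
      from subsetD[OF P(4)[OF B(1)] B(2)]
      obtain x where "x \<in> P B" "t \<in> {x - A * \<rho>..x + A * \<rho>}"
        by (rule UN_E) (rule that)
      thus "t \<in> (\<Union>x\<in>?P. {x - A * \<rho>..x + A * \<rho>})" using B(1) by (intro UN_I[of x] UN_I[of B])
    qed
    have "card ?P \<le> (\<Sum>B\<in>\<B>. card (P B))" by (rule card_UN_le[OF \<B>(1)])
    also have "\<dots> \<le> card \<B> * q" using P(3) sum_bounded_above[of \<B> "\<lambda>B. card (P B)" q] by simp
    finally have count: "real (card ?P) \<le> real (card \<B>) * real q" by (simp flip: of_nat_mult)
    have "c * d powr s \<le> real (card ?P) * (C * (A * \<rho>) powr s)"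
      using ahlfors_net_card_ge[OF T(2) r fin sub cover] T(3) by simp
    also have "\<dots> \<le> (real (card \<B>) * real q) * (C * (A * \<rho>) powr s)"
      using count pos by (intro mult_right_mono) auto
    also have "\<dots> = real (card \<B>) * (real q * (C * A powr s) * \<rho> powr s)"
      using Aq \<rho> by (simp add: powr_mult)
    finally have "c * d powr s / (real q * (C * A powr s) * \<rho> powr s) \<le> real (card \<B>)"
      using Aq \<rho> pos by (simp add: pos_divide_le_eq)
    thus ?thesis by (simp add: K_def powr_minus divide_inverse mult_ac)
  qed
  ultimately show thesis by (rule that)
qed

theorem proposition4p8:
  fixes \<gamma> :: "real \<Rightarrow> real ^ 'n" and idx :: "'n \<Rightarrow> nat"
    and U :: "real set" and a b s c C d :: real
  assumes "bij_betw idx UNIV {1..CARD('n)}"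
    and "open U" and "is_interval U"
    and "a \<le> b" and "{a..b} \<subseteq> U"
    and "Ck_embedding (CARD('n) + 1) \<gamma> U"
    and "\<And>t. t \<in> {a..b} \<Longrightarrow> derivs_det idx \<gamma> t \<noteq> 0"
    and "0 < s" and "s \<le> 1" and "0 < c" and "c \<le> C" and "0 < d"
  shows "\<exists>K1>0. \<exists>K2>0. \<forall>T. T \<subseteq> {a..b} \<and> ahlfors_regular_with s c C T \<and> diameter T = d \<longrightarrow>
           (\<forall>\<delta>\<in>Delta CARD('n).
              K1 * (MIN i\<in>{1..CARD('n)}. \<delta> i powr (1 / real i)) powr (- s)
                \<le> real (box_covering_number (\<gamma> ` T) \<delta>) \<and>
              real (box_covering_number (\<gamma> ` T) \<delta>)
                \<le> K2 * (MIN i\<in>{1..CARD('n)}. \<delta> i powr (1 / real i)) powr (- s))"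
proof -
  let ?n = "CARD('n)"
  define G where "G j = nth_vderiv j \<gamma>" for j
  have G0: "G 0 = \<gamma>" by (simp add: G_def nth_vderiv_def)
  have GSuc: "G (Suc j) t = vector_derivative (G j) (at t)" for j t
    by (simp add: G_def nth_vderiv_def)
  have diff: "G j differentiable (at t)" if "j \<le> ?n" "t \<in> {a..b}" for j t
    using \<open>Ck_embedding (CARD('n) + 1) \<gamma> U\<close> \<open>{a..b} \<subseteq> U\<close> that
    by (auto simp: Ck_embedding_def Ck_on_def G_def)
  have deriv: "(G j has_vector_derivative G (Suc j) t) (at t)" if "j < ?n" "t \<in> {a..b}" for j t
    using diff[of j t] that by (simp add: GSuc vector_derivative_works)
  have cont: "continuous_on {a..b} (G k)" if "k \<in> {1..?n}" for k
    using diff that by (intro continuous_at_imp_continuous_on ballI differentiable_imp_continuous_within) auto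
  have det: "det ((\<chi> i j. G (idx j) t $ i) :: real ^ 'n ^ 'n) \<noteq> 0" if "t \<in> {a..b}" for t
    using assms(7)[OF that] by (simp add: derivs_det_def G_def)
  have pos: "0 < c" "0 < C" "0 < d" using assms by auto
  obtain K1 where K1: "0 < K1" and lower: "\<And>T \<delta> \<rho> i \<B>. T \<subseteq> {a..b} \<Longrightarrow> ahlfors_regular_with s c C T \<Longrightarrow> diameter T = d \<Longrightarrow>
      \<delta> \<in> Delta CARD('n) \<Longrightarrow> 0 < \<rho> \<Longrightarrow> \<rho> \<le> 1 \<Longrightarrow> i \<in> {1..CARD('n)} \<Longrightarrow> \<delta> i = \<rho> ^ i \<Longrightarrow>
      finite \<B> \<Longrightarrow> (\<forall>B\<in>\<B>. admissible_box \<delta> B) \<Longrightarrow> G 0 ` T \<subseteq> \<Union>\<B> \<Longrightarrow>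
      K1 * \<rho> powr (- s) \<le> real (card \<B>)"
    by (rule box_covering_lower[where G = G, OF assms(1) deriv cont det pos]) (assumption+, rule that)
  obtain K2 where K2: "0 < K2" and upper: "\<And>T \<delta> \<rho>. T \<subseteq> {a..b} \<Longrightarrow> ahlfors_regular_with s c C T \<Longrightarrow> diameter T = d \<Longrightarrow>
      \<delta> \<in> Delta CARD('n) \<Longrightarrow> 0 < \<rho> \<Longrightarrow> \<rho> \<le> 1 \<Longrightarrow> (\<forall>i\<in>{1..CARD('n)}. \<rho> ^ i \<le> \<delta> i) \<Longrightarrow>
      \<exists>\<B>. finite \<B> \<and> (\<forall>B\<in>\<B>. admissible_box \<delta> B) \<and> G 0 ` T \<subseteq> \<Union>\<B> \<and>
           real (card \<B>) \<le> K2 * \<rho> powr (- s)"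
    by (rule box_covering_upper[where G = G, OF deriv cont pos]) (assumption+, rule that)
  have "K1 * (MIN i\<in>{1..?n}. \<delta> i powr (1 / real i)) powr (- s) \<le> real (box_covering_number (\<gamma> ` T) \<delta>) \<and>
        real (box_covering_number (\<gamma> ` T) \<delta>) \<le> K2 * (MIN i\<in>{1..?n}. \<delta> i powr (1 / real i)) powr (- s)"
    if T: "T \<subseteq> {a..b}" "ahlfors_regular_with s c C T" "diameter T = d" and \<delta>: "\<delta> \<in> Delta ?n" for T \<delta>
  proof -
    define \<rho> where "\<rho> = (MIN i\<in>{1..?n}. \<delta> i powr (1 / real i))"
    have \<rho>: "0 < \<rho>" "\<rho> \<le> 1" "\<forall>i\<in>{1..?n}. \<rho> ^ i \<le> \<delta> i" "\<exists>i\<in>{1..?n}. \<delta> i = \<rho> ^ i"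
      using Delta_scale[OF \<delta>] by (simp_all add: \<rho>_def Suc_le_eq)
    then obtain i where i: "i \<in> {1..?n}" "\<delta> i = \<rho> ^ i" by blast
    obtain \<B> where \<B>: "finite \<B>" "\<forall>B\<in>\<B>. admissible_box \<delta> B" "\<gamma> ` T \<subseteq> \<Union>\<B>"
        "real (card \<B>) \<le> K2 * \<rho> powr (- s)"
      using upper[OF T \<delta> \<rho>(1,2,3)] unfolding G0 by blast
    let ?covers = "\<lambda>k. \<exists>\<B>. finite \<B> \<and> card \<B> = k \<and> (\<forall>B\<in>\<B>. admissible_box \<delta> B) \<and> \<gamma> ` T \<subseteq> \<Union>\<B>"
    have "?covers (card \<B>)" using \<B> by blast
    hence "?covers (box_covering_number (\<gamma> ` T) \<delta>)" "box_covering_number (\<gamma> ` T) \<delta> \<le> card \<B>"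
      unfolding box_covering_number_def by (rule LeastI, rule Least_le)
    moreover from this(1) obtain \<C> where \<C>: "finite \<C>" "card \<C> = box_covering_number (\<gamma> ` T) \<delta>"
        "\<forall>B\<in>\<C>. admissible_box \<delta> B" "\<gamma> ` T \<subseteq> \<Union>\<C>"
      by blast
    moreover have "K1 * \<rho> powr (- s) \<le> real (card \<C>)"
      using lower[OF T \<delta> \<rho>(1,2) i \<C>(1,3)] \<C>(4) by (simp add: G0)
    ultimately show ?thesis unfolding \<rho>_def[symmetric] using \<B>(4) by auto
  qed
  thus ?thesis using K1 K2 by blast
qed

end
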